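(* For every $\epsilon>0$ and for every closed and bounded semialgebraic set $S\subset\mathbb{R}^n$ with $D(S)=(n,c,d)$, there exists a closed semialgebraic set $S'\subset\mathbb{R}^n$ satisfying $$\mathrm{dist}_H(S,S')\le\epsilon$$ and such that $$S'=\bigcup_{i=1}^a\mathrm{Bas}(\mathcal{P}_i,\mathcal{Q}_i;\mathbb{R}),$$ where $\mathcal{P}_i,\mathcal{Q}_i\subset\mathbb{R}[x_1,\dots,x_n]$ are finite families of polynomials with the property that, for every $i=1,\dots,a$, $\#(\mathcal{P}_i\cup\mathcal{Q}_i)\le b$, with $ab\le c$, and with each polynomial in $\mathcal{P}_i\cup\mathcal{Q}_i$ of degree bounded by $d$.
   Context: Diagram: for a semialgebraic set $S\subset\mathbb{R}^n$, a representation of $S$ is a description $$S=\bigcup_{i=1}^a\bigcap_{j=1}^{b_i}\{x\in\mathbb{R}^n\mid \mathrm{sign}(p_{ij}(x))=\sigma_{ij}\}$$ with real polynomials $p_{ij}$ in $n$ variables and $\sigma_{ij}\in\{0,+1,-1\}$. The notation "$D(S)=(m,c,d)$" means that there exists a representation of $S$ of this form with $n\le m$, $a\cdot\max_i b_i\le c$ and $\max_{i,j}\deg(p_{ij})\le d$. For finite sets of polynomials $\mathcal{P},\mathcal{Q}\subset\mathbb{R}[x_1,\dots,x_n]$, the closed basic semialgebraic set is $\mathrm{Bas}(\mathcal{P},\mathcal{Q};\mathbb{R}):=\{x\in\mathbb{R}^n\mid p(x)=0\ \forall p\in\mathcal{P},\ q(x)\le0\ \forall q\in\mathcal{Q}\}$.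 $\mathrm{dist}_H$ is the Hausdorff distance in $\mathbb{R}^n$ (with $\mathrm{dist}_H(\emptyset,\emptyset)=0$). *)

theory Defs
  imports "HOL-Analysis.Analysis" "HOL-Library.Poly_Mapping"
begin

(* Real polynomials in CARD('n) variables, as finitely supported maps from
   exponent vectors to coefficients. *)
type_synonym 'n mpoly = "('n \<Rightarrow>\<^sub>0 nat) \<Rightarrow>\<^sub>0 real"

definition mp_eval :: "'n::finite mpoly \<Rightarrow> real ^ 'n \<Rightarrow> real" where
  "mp_eval p x = (\<Sum>m\<in>Poly_Mapping.keys p.
     Poly_Mapping.lookup p m * (\<Prod>k\<in>UNIV. (x $ k) ^ Poly_Mapping.lookup m k))"

(* Total degree; the zero polynomial gets degree 0. *)
definition mp_degree :: "'n::finite mpoly \<Rightarrow> nat" where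
  "mp_degree p = Max (insert 0
     ((\<lambda>m. \<Sum>k\<in>UNIV. Poly_Mapping.lookup m k) ` Poly_Mapping.keys p))"

definition representation ::
  "(real ^ 'n::finite) set \<Rightarrow> nat \<Rightarrow> (nat \<Rightarrow> nat) \<Rightarrow>
   (nat \<Rightarrow> nat \<Rightarrow> 'n mpoly) \<Rightarrow> (nat \<Rightarrow> nat \<Rightarrow> real) \<Rightarrow> bool" where
  "representation S a b p \<sigma> \<longleftrightarrow>
     (\<forall>i<a. \<forall>j<b i. \<sigma> i j \<in> {0, 1, -1}) \<and>
     S = (\<Union>i<a. \<Inter>j<b i. {x. sgn (mp_eval (p i j) x) = \<sigma> i j})"

definition semialgebraic :: "(real ^ 'n::finite) set \<Rightarrow> bool" where
  "semialgebraic S \<longleftrightarrow> (\<exists>a b p \<sigma>. representation S a b p \<sigma>)"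

(* The relation D(S) = (m,c,d), which only asserts upper bounds.  If a = 0, the
   maximum ranges over the empty set, but it is then multiplied by 0. *)
definition diagram :: "(real ^ 'n::finite) set \<Rightarrow> nat \<Rightarrow> nat \<Rightarrow> nat \<Rightarrow> bool" where
  "diagram S m c d \<longleftrightarrow> (\<exists>a b p \<sigma>. representation S a b p \<sigma> \<and>
     CARD('n) \<le> m \<and>
     a * (MAX i\<in>{..<a}. b i) \<le> c \<and>
     (\<forall>i<a. \<forall>j<b i. mp_degree (p i j) \<le> d))"

definition Bas :: "'n::finite mpoly set \<Rightarrow> 'n mpoly set \<Rightarrow> (real ^ 'n) set" where
  "Bas P Q = {x. (\<forall>p\<in>P. mp_eval p x = 0) \<and> (\<forall>q\<in>Q. mp_eval q x \<le> 0)}"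

(* With values in [0,\<infinity>], the conventions SUP over {} = 0 and INF over {} = \<infinity>
   give distance 0 between {} and {}, and \<infinity> between {} and a nonempty set. *)
definition hausdorff_dist :: "'a::metric_space set \<Rightarrow> 'a set \<Rightarrow> ennreal" where
  "hausdorff_dist A B = max (SUP x\<in>A. INF y\<in>B. ennreal (dist x y))
                            (SUP y\<in>B. INF x\<in>A. ennreal (dist x y))"

end

theory Submission
  imports Defs
begin

text \<open>
  Replace the conditions \<open>p < 0\<close> and \<open>p > 0\<close> by \<open>p + \<delta> \<le> 0\<close> and \<open>-p + \<delta> \<le> 0\<close>, keeping
  the equations. The resulting closed sets are contained in \<open>S\<close> and exhaust it as \<open>\<delta>\<close> tends to
  \<open>0\<close> from the right. Since \<open>S\<close> is compact, it has a finite \<open>\<epsilon>\<close>-net in \<open>S\<close>, which is contained in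
  the shrunken set as soon as \<open>\<delta>\<close> is small enough.
\<close>

section \<open>Evaluation and degree of polynomials\<close>

lemma mp_eval_superset:
  fixes p :: "'n::finite mpoly"
  assumes "finite A" "Poly_Mapping.keys p \<subseteq> A"
  shows "mp_eval p x = (\<Sum>m\<in>A.
     Poly_Mapping.lookup p m * (\<Prod>k\<in>UNIV. (x $ k) ^ Poly_Mapping.lookup m k))"
  unfolding mp_eval_def using assms by (intro sum.mono_neutral_left) (auto simp: in_keys_iff)

lemma mp_eval_add: "mp_eval (p + q) x = mp_eval p x + mp_eval q x"
proof -
  let ?A = "Poly_Mapping.keys p \<union> Poly_Mapping.keys q"
  have "finite ?A" "Poly_Mapping.keys (p + q) \<subseteq> ?A"
    by (simp_all add: Poly_Mapping.keys_add)
  then show ?thesis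
    by (subst (1 2 3) mp_eval_superset[of ?A])
       (auto simp: lookup_add distrib_right sum.distrib)
qed

lemma mp_eval_uminus: "mp_eval (- p) x = - mp_eval p x"
proof -
  have "Poly_Mapping.keys (- p) = Poly_Mapping.keys p"
    by (auto simp: in_keys_iff)
  then show ?thesis
    by (simp add: mp_eval_def sum_negf)
qed

lemma mp_eval_single_0: "mp_eval (Poly_Mapping.single 0 c) x = c"
  by (simp add: mp_eval_superset[of "{0}"])

lemma continuous_on_mp_eval [continuous_intros]: "continuous_on A (mp_eval p)"
  unfolding mp_eval_def [abs_def] by (intro continuous_intros)

text \<open>Trades the maximum for a condition on single monomials. The inserted \<open>0\<close>
  keeps the maximum defined for the zero polynomial and costs nothing, as
  \<open>0 \<le> d\<close>.\<close>

lemma mp_degree_le_iff: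
  "mp_degree p \<le> d \<longleftrightarrow>
     (\<forall>m\<in>Poly_Mapping.keys p. (\<Sum>k\<in>UNIV. Poly_Mapping.lookup m k) \<le> d)"
  unfolding mp_degree_def by (subst Max_le_iff) auto

lemma mp_degree_add_le: "mp_degree p \<le> d \<Longrightarrow> mp_degree q \<le> d \<Longrightarrow> mp_degree (p + q) \<le> d"
  unfolding mp_degree_le_iff using Poly_Mapping.keys_add[of p q] by blast

lemma mp_degree_uminus_le: "mp_degree p \<le> d \<Longrightarrow> mp_degree (- p) \<le> d"
  by (auto simp: mp_degree_le_iff in_keys_iff)

lemma mp_degree_single_0_le: "mp_degree (Poly_Mapping.single 0 c) \<le> d"
  by (auto simp: mp_degree_le_iff)

section \<open>Closedness and semialgebraicity of unions of basic closed sets\<close>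

lemma closed_Bas: "closed (Bas P Q)"
proof -
  have "Bas P Q = (\<Inter>p\<in>P. {x. mp_eval p x = 0}) \<inter> (\<Inter>q\<in>Q. {x. mp_eval q x \<le> 0})"
    by (auto simp: Bas_def)
  also have "closed \<dots>"
    by (intro closed_Int closed_INT ballI closed_Collect_eq closed_Collect_le continuous_intros)
  finally show ?thesis .
qed

text \<open>Sign conditions are kept as sets of pairs, so that cells and families of cells can be
  formed by set operations without reindexing.\<close>

definition sign_cell :: "('n::finite mpoly \<times> real) set \<Rightarrow> (real ^ 'n) set" where
  "sign_cell C = {x. \<forall>(p, s)\<in>C. sgn (mp_eval p x) = s}"

lemma sign_cellD: "x \<in> sign_cell C \<Longrightarrow> (p, s) \<in> C \<Longrightarrow> sgn (mp_eval p x) = s"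
  by (auto simp: sign_cell_def)

definition sign_family :: "('n::finite mpoly \<times> real) set set \<Rightarrow> bool" where
  "sign_family F \<longleftrightarrow> finite F \<and> (\<forall>C\<in>F. finite C \<and> snd ` C \<subseteq> {0, 1, -1})"

lemma sign_family_UN:
  "finite I \<Longrightarrow> (\<And>i. i \<in> I \<Longrightarrow> sign_family (F i)) \<Longrightarrow> sign_family (\<Union>i\<in>I. F i)"
  by (auto simp: sign_family_def)

text \<open>The only place where indices appear: the finite family and each of its finite cells are
  enumerated by initial segments of the naturals, as \<open>representation\<close> demands.\<close>

lemma semialgebraic_sign_family:
  assumes "sign_family F"
  shows "semialgebraic (\<Union>C\<in>F. sign_cell C)"
proof -
  have fin: "finite F" and fC: "\<And>C. C \<in> F \<Longrightarrow> finite C"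
    and sg: "\<And>C. C \<in> F \<Longrightarrow> snd ` C \<subseteq> {0, 1, -1}"
    using assms by (auto simp: sign_family_def)
  from fin obtain e where e: "bij_betw e {..<card F} F"
    by (metis bij_betw_from_nat_into_finite)
  have "\<forall>C\<in>F. \<exists>f. bij_betw f {..<card C} C"
    using fC by (metis bij_betw_from_nat_into_finite)
  then obtain f where f: "\<And>C. C \<in> F \<Longrightarrow> bij_betw (f C) {..<card C} C"
    by metis
  let ?b = "\<lambda>i. card (e i)"
  let ?t = "\<lambda>i. f (e i)"
  have eF: "e ` {..<card F} = F"
    using e by (simp add: bij_betw_def)
  have t: "?t i ` {..<?b i} = e i" if "i < card F" for i
    using f[of "e i"] eF that by (auto simp: bij_betw_def)
  have "representation (\<Union>C\<in>F. sign_cell C) (card F) ?b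
          (\<lambda>i j. fst (?t i j)) (\<lambda>i j. snd (?t i j))"
    unfolding representation_def
  proof (intro conjI allI impI)
    fix i j assume "i < card F" "j < ?b i"
    then show "snd (?t i j) \<in> {0, 1, -1}"
      using t[of i] sg[of "e i"] eF by blast
  next
    have "sign_cell (e i) =
        (\<Inter>j<?b i. {x. sgn (mp_eval (fst (?t i j)) x) = snd (?t i j)})" if "i < card F" for i
      by (subst t[OF that, symmetric]) (auto simp: sign_cell_def split_beta)
    then show "(\<Union>C\<in>F. sign_cell C) = (\<Union>i<card F. \<Inter>j<?b i.
        {x. sgn (mp_eval (fst (?t i j)) x) = snd (?t i j)})"
      by (subst eF[symmetric]) simp
  qed
  then show ?thesis
    unfolding semialgebraic_def by blast
qed

text \<open>Each \<open>q \<le> 0\<close> splits into \<open>q = 0\<close> or \<open>q < 0\<close>, so the cells are indexed by the set \<open>Z \<subseteq> Q\<close>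
  of those polynomials that vanish.\<close>
lemma Bas_sign_family:
  assumes "finite P" "finite Q"
  shows "\<exists>F. sign_family F \<and> Bas P Q = (\<Union>C\<in>F. sign_cell C)"
proof (intro exI conjI)
  let ?C = "\<lambda>Z. (P \<union> Z) \<times> {0} \<union> (Q - Z) \<times> {-1}"
  show "sign_family (?C ` Pow Q)"
    using assms by (auto simp: sign_family_def intro: finite_subset)
  show "Bas P Q = (\<Union>C\<in>?C ` Pow Q. sign_cell C)"
  proof (intro subset_antisym subsetI)
    fix x assume x: "x \<in> Bas P Q"
    let ?Z = "{q \<in> Q. mp_eval q x = 0}"
    have "sgn (mp_eval q x) = -1" if "q \<in> Q - ?Z" for q
    proof -
      have "mp_eval q x \<le> 0" "mp_eval q x \<noteq> 0"
        using x that by (simp_all add: Bas_def)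
      then show ?thesis
        by simp
    qed
    moreover have "sgn (mp_eval p x) = 0" if "p \<in> P \<union> ?Z" for p
      using x that by (auto simp: Bas_def)
    ultimately have "x \<in> sign_cell (?C ?Z)"
      unfolding sign_cell_def by blast
    then show "x \<in> (\<Union>C\<in>?C ` Pow Q. sign_cell C)"
      by (intro UN_I[of "?C ?Z"] imageI) auto
  next
    fix x assume "x \<in> (\<Union>C\<in>?C ` Pow Q. sign_cell C)"
    then obtain Z where Z: "Z \<subseteq> Q" and x: "x \<in> sign_cell (?C Z)"
      by auto
    have sgn_x: "sgn (mp_eval p x) = s" if "(p, s) \<in> ?C Z" for p s
      using sign_cellD[OF x that] .
    have "mp_eval p x = 0" if "p \<in> P" for p
      using sgn_x[of p 0] that by (auto simp: sgn_0_0)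
    moreover have "mp_eval q x \<le> 0" if "q \<in> Q" for q
      using sgn_x[of q 0] sgn_x[of q "-1"] that by (cases "q \<in> Z") (auto simp: sgn_0_0 sgn_1_neg)
    ultimately show "x \<in> Bas P Q"
      by (simp add: Bas_def)
  qed
qed

lemma semialgebraic_UN_Bas:
  assumes "\<And>i. i < (a::nat) \<Longrightarrow> finite (P i) \<and> finite (Q i)"
  shows "semialgebraic (\<Union>i<a. Bas (P i) (Q i))"
proof -
  have "\<forall>i\<in>{..<a}. \<exists>F. sign_family F \<and> Bas (P i) (Q i) = (\<Union>C\<in>F. sign_cell C)"
    using assms by (auto intro!: Bas_sign_family)
  then obtain F where F: "\<And>i. i < a \<Longrightarrow> sign_family (F i)"
      "\<And>i. i < a \<Longrightarrow> Bas (P i) (Q i) = (\<Union>C\<in>F i. sign_cell C)"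
    by (metis lessThan_iff)
  have "(\<Union>i<a. Bas (P i) (Q i)) = (\<Union>C\<in>(\<Union>i<a. F i). sign_cell C)"
    using F(2) by auto
  then show ?thesis
    using semialgebraic_sign_family[OF sign_family_UN[of "{..<a}" F]] F(1) by simp
qed

section \<open>Hausdorff approximation from inside by shrunken sets\<close>

lemma hausdorff_dist_subset_le:
  assumes "T \<subseteq> S" and "\<And>x. x \<in> S \<Longrightarrow> \<exists>y\<in>T. dist x y \<le> \<epsilon>"
  shows "hausdorff_dist S T \<le> ennreal \<epsilon>"
  unfolding hausdorff_dist_def
proof (intro max.boundedI SUP_least)
  fix x assume "x \<in> S"
  then obtain y where "y \<in> T" "dist x y \<le> \<epsilon>"
    using assms(2) by blast
  then show "(INF y\<in>T. ennreal (dist x y)) \<le> ennreal \<epsilon>"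
    by (auto intro: INF_lower2 ennreal_leI)
next
  \<comment> \<open>As \<open>T \<subseteq> S\<close>, the point \<open>y\<close> is its own partner
    in \<open>S\<close>, at distance \<open>0\<close>.\<close>
  fix y assume "y \<in> T"
  then show "(INF x\<in>S. ennreal (dist x y)) \<le> ennreal \<epsilon>"
    using assms(1) by (intro INF_lower2[of y]) auto
qed

text \<open>Including the sign \<open>0\<close>, where nothing changes, makes equations and
  inequalities together the image of one index set, which gives the cardinality bound. The summand
  \<open>Poly_Mapping.single 0 \<delta>\<close> is the constant polynomial.\<close>

definition shrink :: "real \<Rightarrow> 'n::finite mpoly \<Rightarrow> real \<Rightarrow> 'n mpoly" where
  "shrink \<delta> p s = (if s = 0 then p else (if s = 1 then - p else p) + Poly_Mapping.single 0 \<delta>)"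

lemma mp_eval_shrink:
  "mp_eval (shrink \<delta> p s) x =
     (if s = 0 then mp_eval p x else (if s = 1 then - mp_eval p x else mp_eval p x) + \<delta>)"
  by (simp add: shrink_def mp_eval_add mp_eval_uminus mp_eval_single_0)

lemma mp_degree_shrink_le: "mp_degree p \<le> d \<Longrightarrow> mp_degree (shrink \<delta> p s) \<le> d"
  by (simp add: shrink_def mp_degree_add_le mp_degree_uminus_le mp_degree_single_0_le)

theorem proposition38:
  fixes S :: "(real ^ 'n::finite) set" and \<epsilon> :: real and c d :: nat
  assumes "\<epsilon> > 0"
    and "semialgebraic S" "closed S" "bounded S"
    and "diagram S CARD('n) c d"
  shows "\<exists>S' :: (real ^ 'n) set.
           closed S' \<and> semialgebraic S' \<and>
           hausdorff_dist S S' \<le> ennreal \<epsilon> \<and>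
           (\<exists>(a::nat) (b::nat) (P :: nat \<Rightarrow> 'n mpoly set) (Q :: nat \<Rightarrow> 'n mpoly set).
              S' = (\<Union>i<a. Bas (P i) (Q i)) \<and>
              a * b \<le> c \<and>
              (\<forall>i<a. finite (P i) \<and> finite (Q i) \<and>
                     card (P i \<union> Q i) \<le> b \<and>
                     (\<forall>p\<in>P i \<union> Q i. mp_degree p \<le> d)))"
proof -
  obtain a b p \<sigma> where rep: "representation S a b p \<sigma>"
    and size: "a * (MAX i\<in>{..<a}. b i) \<le> c"
    and deg: "\<And>i j. i < a \<Longrightarrow> j < b i \<Longrightarrow> mp_degree (p i j) \<le> d"
    using assms(5) unfolding diagram_def by blast
  have \<sigma>: "\<And>i j. i < a \<Longrightarrow> j < b i \<Longrightarrow> \<sigma> i j \<in> {0, 1, -1}"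
    and S: "S = (\<Union>i<a. \<Inter>j<b i. {x. sgn (mp_eval (p i j) x) = \<sigma> i j})"
    using rep unfolding representation_def by blast+
  define P where "P i = p i ` {j \<in> {..<b i}. \<sigma> i j = 0}" for i
  define Q where "Q \<delta> i = (\<lambda>j. shrink \<delta> (p i j) (\<sigma> i j)) ` {j \<in> {..<b i}. \<sigma> i j \<noteq> 0}" for \<delta> i
  define T where "T \<delta> = (\<Union>i<a. Bas (P i) (Q \<delta> i))" for \<delta>

  have T_subset: "T \<delta> \<subseteq> S" if "\<delta> > 0" for \<delta>
  proof
    fix x assume "x \<in> T \<delta>"
    then obtain i where i: "i < a" and x: "x \<in> Bas (P i) (Q \<delta> i)"
      by (auto simp: T_def)
    have "sgn (mp_eval (p i j) x) = \<sigma> i j" if j: "j < b i" for j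
    proof (cases "\<sigma> i j = 0")
      case True
      then show ?thesis
        using x j by (auto simp: Bas_def P_def)
    next
      case False
      then have "mp_eval (shrink \<delta> (p i j) (\<sigma> i j)) x \<le> 0"
        using x j by (auto simp: Bas_def Q_def)
      then show ?thesis
        \<comment> \<open>For sign \<open>1\<close> the value of \<open>p i j\<close> is at least
          \<open>\<delta>\<close>, for sign \<open>-1\<close> at most \<open>-\<delta>\<close>; so
          the strict sign is recovered.\<close>
        using \<sigma>[OF i j] False \<open>\<delta> > 0\<close> by (auto simp: mp_eval_shrink)
    qed
    then show "x \<in> S"
      using i S by auto
  qed

  have T_exhausts: "\<forall>\<^sub>F \<delta> in at_right 0. x \<in> T \<delta>" if "x \<in> S" for x
  proof -
    obtain i where i: "i < a" and x: "\<And>j. j < b i \<Longrightarrow> sgn (mp_eval (p i j) x) = \<sigma> i j"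
      using \<open>x \<in> S\<close> S by auto
    have "\<forall>\<^sub>F \<delta> in at_right 0. mp_eval (shrink \<delta> (p i j) (\<sigma> i j)) x \<le> 0" if j: "j < b i" for j
    proof (cases "mp_eval (p i j) x = 0")
      case True
      then show ?thesis
        \<comment> \<open>Here \<open>\<sigma> i j = 0\<close>, so \<open>shrink\<close> leaves the
          polynomial alone and every \<open>\<delta>\<close> works.\<close>
        using x[OF j] by (simp add: mp_eval_shrink)
    next
      case False
      \<comment> \<open>The shrunken polynomial takes the value \<open>\<delta>\<close> minus this
        absolute value at \<open>x\<close>, which explains the threshold.\<close>
      then have "\<forall>\<^sub>F \<delta> in at_right 0. \<delta> \<in> {0<..<\<bar>mp_eval (p i j) x\<bar>}"
        by (intro eventually_at_right_real) simp
      then show ?thesis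
        by eventually_elim (use x[OF j] False in \<open>auto simp: mp_eval_shrink sgn_if split: if_splits\<close>)
    qed
    then have "\<forall>\<^sub>F \<delta> in at_right 0. \<forall>j\<in>{..<b i}. mp_eval (shrink \<delta> (p i j) (\<sigma> i j)) x \<le> 0"
      by (intro eventually_ball_finite) auto
    then show ?thesis
    proof eventually_elim
      case (elim \<delta>)
      have "mp_eval (p i j) x = 0" if "j < b i" "\<sigma> i j = 0" for j
        using x[OF that(1)] that(2) by (simp add: sgn_0_0)
      then have "x \<in> Bas (P i) (Q \<delta> i)"
        using elim by (auto simp: Bas_def P_def Q_def)
      then show ?case
        using i by (auto simp: T_def)
    qed
  qed

  have "compact S"
    using assms(3,4) by (simp add: compact_eq_bounded_closed)
  then obtain K where K: "finite K" "K \<subseteq> S" "S \<subseteq> (\<Union>x\<in>K. ball x \<epsilon>)"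
    using assms(1) by (metis compact_imp_seq_compact seq_compact_imp_totally_bounded)
  \<comment> \<open>In \<open>T_exhausts\<close> the range of good \<open>\<delta>\<close> depends
    on the point; finiteness of \<open>K\<close> yields a common one, and
    \<open>K \<subseteq> S\<close> makes the fact applicable.\<close>
  have "\<forall>\<^sub>F \<delta> in at_right 0. \<forall>x\<in>K. x \<in> T \<delta>"
    using K T_exhausts by (intro eventually_ball_finite) auto
  then have "\<forall>\<^sub>F \<delta> in at_right (0::real). \<delta> > 0 \<and> K \<subseteq> T \<delta>"
    using eventually_at_right_less by eventually_elim auto
  then obtain \<delta> :: real where \<delta>: "\<delta> > 0" "K \<subseteq> T \<delta>"
    using eventually_happens trivial_limit_at_right_real by blast

  have fin: "finite (P i) \<and> finite (Q \<delta> i)" for i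
    by (simp add: P_def Q_def)
  \<comment> \<open>Each sign condition becomes exactly one equation or inequality, so the count
    does not grow.\<close>
  have P_Q: "P i \<union> Q \<delta> i = (\<lambda>j. shrink \<delta> (p i j) (\<sigma> i j)) ` {..<b i}" for i
    by (auto simp: P_def Q_def shrink_def image_iff)
  have card_le: "card (P i \<union> Q \<delta> i) \<le> (MAX i\<in>{..<a}. b i)" if "i < a" for i
  proof -
    have "card (P i \<union> Q \<delta> i) \<le> b i"
      unfolding P_Q using card_image_le[of "{..<b i}"] by simp
    also have "b i \<le> (MAX i\<in>{..<a}. b i)"
      using that by (intro Max_ge) auto
    finally show ?thesis .
  qed

  show ?thesis
  proof (intro exI[of _ "T \<delta>"] conjI)
    show "closed (T \<delta>)"
      unfolding T_def by (intro closed_UN closed_Bas ballI) simp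
    show "semialgebraic (T \<delta>)"
      unfolding T_def using fin by (intro semialgebraic_UN_Bas) auto
    show "hausdorff_dist S (T \<delta>) \<le> ennreal \<epsilon>"
    proof (rule hausdorff_dist_subset_le)
      fix x assume "x \<in> S"
      then obtain k where "k \<in> K" "dist k x < \<epsilon>"
        using K by auto
      then show "\<exists>y\<in>T \<delta>. dist x y \<le> \<epsilon>"
        using \<delta> by (intro bexI[of _ k]) (auto simp: dist_commute)
    qed (rule T_subset[OF \<delta>(1)])
    show "\<exists>(a::nat) b P Q. T \<delta> = (\<Union>i<a. Bas (P i) (Q i)) \<and> a * b \<le> c \<and>
              (\<forall>i<a. finite (P i) \<and> finite (Q i) \<and> card (P i \<union> Q i) \<le> b \<and>
                     (\<forall>p\<in>P i \<union> Q i. mp_degree p \<le> d))"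
      \<comment> \<open>With the maximum from the diagram as the witness for the uniform bound,
        \<open>a * b \<le> c\<close> is \<open>size\<close> itself, also for \<open>a = 0\<close>,
        where the maximum is unspecified.\<close>
      using T_def size fin card_le deg unfolding P_Q
      by (intro exI[of _ a] exI[of _ "MAX i\<in>{..<a}. b i"] exI[of _ P] exI[of _ "Q \<delta>"])
         (auto simp: P_Q mp_degree_shrink_le)
  qed
qed

end
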